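(* Let $r$ be a positive integer. If $H$ is an $r$-layer hexagonal silicate sheet, then $\mathrm{gpack}(H)=\mathrm{gt}(H)$.
   Context: A geodesic in a graph $G$ is a shortest path between two vertices. A geodesic is maximal if it is not a (proper) subpath of another geodesic of $G$. A set $S\subseteq V(G)$ is a geodesic transversal of $G$ if every maximal geodesic of $G$ contains at least one vertex of $S$. The geodesic transversal number $\mathrm{gt}(G)$ is the minimum cardinality of a geodesic transversal of $G$. A geodesic packing of $G$ is a set of maximal geodesics of $G$ that are mutually vertex-disjoint. The geodesic packing number $\mathrm{gpack}(G)$ is the maximum cardinality of a geodesic packing of $G$. The $r$-layer hexagonal carbon nanosheet is the finite subgraph of the hexagonal lattice consisting of all vertices and edges of a central hexagon and of the $r-1$ layers of hexagons around it (i.e. of all hexagons at distance at most $r-1$ from the central one, where two hexagons are neighbors if they share an edge). The $1$-layer hexagonal carbon nanosheet is a single $6$-cycle. A silicate sheet is a graph whose vertices are silicon vertices and oxygen vertices, where each edge joins a silicon vertex and an oxygen vertex, each silicon vertex has exactly $4$ oxygen neighbors, each oxygen vertex has one or two silicon neighbors, and two silicon vertices have at most one common oxygen neighbor. Smoothing a vertex $v$ of degree $2$ with neighbors $x,y$ means removing $v$ and adding the edge $xy$. For a silicate sheet $H$, let $\mathrm{SM}(H)$ be the graph obtained from $H$ by smoothing all vertices of degree $2$. If the graph obtained from $\mathrm{SM}(H)$ by deleting all of its pendant vertices (vertices of degree $1$) is the $r$-layer hexagonal carbon nanosheet, then $H$ is called an $r$-layer hexagonal silicate sheet. Equivalently,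 $H$ is obtained from the $r$-layer hexagonal carbon nanosheet $G$ by subdividing every edge exactly once and attaching $4-\deg_G(v)$ pendant vertices to each vertex $v\in V(G)$. *)

theory Defs
  imports "Graph_Theory.Graph_Theory" "HOL-Library.Sublist"
begin

text \<open>
  A finite simple graph is a \<open>pair_graph\<close> (finite, symmetric, loop-free), each edge being
  represented by its two opposite arcs; hence \<open>out_degree\<close> is the degree and
  \<open>vpath\<close> is an undirected path, given as the list of its vertices.
\<close>

definition geodesic :: "'a pair_pre_digraph \<Rightarrow> 'a list \<Rightarrow> bool" where
  "geodesic G p \<longleftrightarrow> vpath p G \<and>
     (\<forall>q. vpath q G \<and> hd q = hd p \<and> last q = last p \<longrightarrow> vwalk_length p \<le> vwalk_length q)"

text \<open>
  A path and its reversal are two lists for the same path. This affects neither maximality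
  (the reversal of a geodesic is a geodesic) nor packings (the two lists share their vertices,
  so at most one of them occurs in a packing).
\<close>

definition maximal_geodesic :: "'a pair_pre_digraph \<Rightarrow> 'a list \<Rightarrow> bool" where
  "maximal_geodesic G p \<longleftrightarrow> geodesic G p \<and> \<not> (\<exists>q. geodesic G q \<and> strict_sublist p q)"

definition geodesic_transversal :: "'a pair_pre_digraph \<Rightarrow> 'a set \<Rightarrow> bool" where
  "geodesic_transversal G S \<longleftrightarrow>
     S \<subseteq> pverts G \<and> (\<forall>p. maximal_geodesic G p \<longrightarrow> set p \<inter> S \<noteq> {})"

definition geodesic_packing :: "'a pair_pre_digraph \<Rightarrow> 'a list set \<Rightarrow> bool" where
  "geodesic_packing G P \<longleftrightarrow> (\<forall>p\<in>P. maximal_geodesic G p) \<and>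
     (\<forall>p\<in>P. \<forall>q\<in>P. p \<noteq> q \<longrightarrow> set p \<inter> set q = {})"

definition gt :: "'a pair_pre_digraph \<Rightarrow> nat" where
  "gt G = Min {card S | S. geodesic_transversal G S}"

definition gpack :: "'a pair_pre_digraph \<Rightarrow> nat" where
  "gpack G = Max {card P | P. geodesic_packing G P}"

text \<open>
  The hexagonal lattice. Its hexagons are indexed by the triangular lattice: \<open>(a, b)\<close> borders
  on \<open>(a \<plusminus> 1, b)\<close>, \<open>(a, b \<plusminus> 1)\<close> and \<open>\<plusminus>(1, -1) + (a, b)\<close>. Every lattice vertex is the common
  corner of three pairwise bordering hexagons: \<open>(a, b, False)\<close> is the common corner of
  \<open>(a, b)\<close>, \<open>(a + 1, b)\<close>, \<open>(a, b + 1)\<close>, and \<open>(a, b, True)\<close> that of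
  \<open>(a + 1, b)\<close>, \<open>(a, b + 1)\<close>, \<open>(a + 1, b + 1)\<close>. Two corners are joined by an edge iff they
  have two hexagons in common.
\<close>

type_synonym hex_vertex = "int \<times> int \<times> bool"

definition hex_lattice_arcs :: "hex_vertex rel" where
  "hex_lattice_arcs = symcl {((a, b, False), (c, d, True)) | a b c d.
     (c, d) \<in> {(a, b), (a - 1, b), (a, b - 1)}}"

fun hexagon :: "int \<times> int \<Rightarrow> hex_vertex set" where
  "hexagon (a, b) =
     {(a, b, False), (a - 1, b, False), (a, b - 1, False),
      (a - 1, b, True), (a, b - 1, True), (a - 1, b - 1, True)}"

definition hexagon_arcs :: "int \<times> int \<Rightarrow> hex_vertex rel" where
  "hexagon_arcs c = hex_lattice_arcs \<inter> hexagon c \<times> hexagon c"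

definition hexagon_neighbors :: "(int \<times> int) rel" where
  "hexagon_neighbors = {(c, d). c \<noteq> d \<and> hexagon_arcs c \<inter> hexagon_arcs d \<noteq> {}}"

definition hexagons_within :: "nat \<Rightarrow> (int \<times> int) set" where
  "hexagons_within n = (\<Union>k\<le>n. (hexagon_neighbors ^^ k) `` {(0, 0)})"

definition carbon_nanosheet :: "nat \<Rightarrow> hex_vertex pair_pre_digraph" where
  "carbon_nanosheet r =
     \<lparr>pverts = (\<Union>c\<in>hexagons_within (r - 1). hexagon c),
      parcs = (\<Union>c\<in>hexagons_within (r - 1). hexagon_arcs c)\<rparr>"

definition silicate_sheet :: "'a pair_pre_digraph \<Rightarrow> bool" where
  "silicate_sheet H \<longleftrightarrow> pair_graph H \<and>
     (\<exists>Si Ox. Si \<union> Ox = pverts H \<and> Si \<inter> Ox = {} \<and>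
        parcs H \<subseteq> Si \<times> Ox \<union> Ox \<times> Si \<and>
        (\<forall>s\<in>Si. card {x\<in>Ox. (s, x) \<in> parcs H} = 4) \<and>
        (\<forall>x\<in>Ox. card {s\<in>Si. (x, s) \<in> parcs H} \<in> {1, 2}) \<and>
        (\<forall>s\<in>Si. \<forall>t\<in>Si. s \<noteq> t \<longrightarrow>
           card {x\<in>Ox. (s, x) \<in> parcs H \<and> (t, x) \<in> parcs H} \<le> 1))"

text \<open>Meaningful for a vertex \<open>v\<close> of degree 2.\<close>

definition smooth :: "'a \<Rightarrow> 'a pair_pre_digraph \<Rightarrow> 'a pair_pre_digraph" where
  "smooth v G =
     \<lparr>pverts = pverts G - {v},
      parcs = {(x, y) \<in> parcs G. x \<noteq> v \<and> y \<noteq> v} \<union>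
              {(x, y). x \<noteq> y \<and> (x, v) \<in> parcs G \<and> (v, y) \<in> parcs G}\<rparr>"

text \<open>
  \<open>is_SM H K\<close>: \<open>K\<close> results from \<open>H\<close> by smoothing its vertices of degree 2 one after another.
  In a silicate sheet these vertices are pairwise non-adjacent, and no two of them have the same
  neighbors, so each step smooths a vertex of degree 2 and the order is irrelevant.
\<close>

definition is_SM :: "'a pair_pre_digraph \<Rightarrow> 'a pair_pre_digraph \<Rightarrow> bool" where
  "is_SM H K \<longleftrightarrow>
     (\<exists>vs. distinct vs \<and> set vs = {v \<in> pverts H. out_degree H v = 2} \<and> K = fold smooth vs H)"

definition delete_pendants :: "'a pair_pre_digraph \<Rightarrow> ('a, 'a \<times> 'a) pre_digraph" where
  "delete_pendants G = with_proj G \<restriction> {v \<in> pverts G. out_degree G v \<noteq> 1}"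

definition hexagonal_silicate_sheet :: "nat \<Rightarrow> 'a pair_pre_digraph \<Rightarrow> bool" where
  "hexagonal_silicate_sheet r H \<longleftrightarrow> silicate_sheet H \<and>
     (\<exists>K. is_SM H K \<and> digraph_iso (delete_pendants K) (with_proj (carbon_nanosheet r)))"

end

theory Submission
  imports Defs
begin

text \<open>
  Call two silicon vertices linked if they share an oxygen vertex. A silicon vertex with two
  pendant neighbors is the center of a maximal geodesic on three vertices; let \<open>D\<close> be the set of
  these. If linked silicon vertices \<open>a\<close>, \<open>b\<close> have pendant neighbors \<open>x\<close>, \<open>y\<close>, then
  \<open>x\<close>, \<open>a\<close>, the shared oxygen, \<open>b\<close>, \<open>y\<close> is a maximal geodesic. Conversely, every maximal
  geodesic contains a vertex of \<open>D\<close> or two linked silicon vertices, since shorter geodesics can be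
  extended. Hence \<open>D\<close> together with a vertex cover of the link graph on the remaining silicon
  vertices is a transversal, and \<open>D\<close> together with a matching in that graph gives a packing. By
  Koenig's theorem both can be chosen of the same size, because the link graph is a subgraph of
  the hexagonal lattice and so is bipartite; as its degrees are at most 3, every silicon vertex has
  a pendant neighbor.
\<close>

section \<open>Koenig's theorem\<close>

text \<open>The two sides may have different types, so a vertex cover is a pair of sets. Finiteness
  is included because \<open>card\<close> is 0 on infinite sets.\<close>

definition bip_cover :: "('a \<times> 'b) set \<Rightarrow> 'a set \<Rightarrow> 'b set \<Rightarrow> bool" where
  "bip_cover E X Y \<longleftrightarrow> finite X \<and> finite Y \<and> (\<forall>(a, b)\<in>E. a \<in> X \<or> b \<in> Y)"

definition bip_cover_number :: "('a \<times> 'b) set \<Rightarrow> nat" where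
  "bip_cover_number E = (LEAST n. \<exists>X Y. bip_cover E X Y \<and> n = card X + card Y)"

lemma bip_cover_number_le: "bip_cover E X Y \<Longrightarrow> bip_cover_number E \<le> card X + card Y"
  unfolding bip_cover_number_def by (rule Least_le) blast

lemma bip_cover_number_attained:
  assumes "finite E"
  obtains X Y where "bip_cover E X Y" "card X + card Y = bip_cover_number E"
proof -
  have "bip_cover E (fst ` E) {}"
    using assms by (force simp: bip_cover_def)
  then have "\<exists>n X Y. bip_cover E X Y \<and> n = card X + card Y"
    by blast
  then have "\<exists>X Y. bip_cover E X Y \<and> bip_cover_number E = card X + card Y"
    unfolding bip_cover_number_def by (rule LeastI_ex)
  then show ?thesis using that by metis
qed

lemma bip_cover_swap: "bip_cover (prod.swap ` E) Y X \<longleftrightarrow> bip_cover E X Y"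
  unfolding bip_cover_def by auto

text \<open>Transfers statements about edges with a common left end to edges with a common right
  end.\<close>

lemma bip_cover_number_swap:
  "bip_cover_number (prod.swap ` E) = bip_cover_number E"
proof -
  have "(\<exists>Y X. bip_cover (prod.swap ` E) Y X \<and> n = card Y + card X) \<longleftrightarrow>
        (\<exists>X Y. bip_cover E X Y \<and> n = card X + card Y)" for n
    unfolding bip_cover_swap by (auto simp: add.commute)
  then show ?thesis unfolding bip_cover_number_def by presburger
qed

text \<open>Were two critical edges \<open>(a, b)\<close>, \<open>(a, b')\<close> adjacent, uncrossing optimal covers of
  the two graphs with one of these edges deleted would give covers of \<open>E\<close> whose sizes add up to
  less than twice the optimum.\<close>

lemma critical_edges_not_adjacent:
  assumes fin: "finite E"
    and e: "(a, b) \<in> E" "bip_cover_number (E - {(a, b)}) < bip_cover_number E"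
    and f: "(a, b') \<in> E" "bip_cover_number (E - {(a, b')}) < bip_cover_number E"
  shows "b = b'"
proof (rule ccontr)
  assume ne: "b \<noteq> b'"
  obtain X Y where c: "bip_cover (E - {(a, b)}) X Y"
    "card X + card Y = bip_cover_number (E - {(a, b)})"
    using bip_cover_number_attained fin finite_Diff by metis
  obtain X' Y' where c': "bip_cover (E - {(a, b')}) X' Y'"
    "card X' + card Y' = bip_cover_number (E - {(a, b')})"
    using bip_cover_number_attained fin finite_Diff by metis
  \<comment> \<open>Either would be a cover of \<open>E\<close> smaller than the optimum, so each
    cover misses exactly the edge deleted for it.\<close>
  have "\<not> bip_cover E X Y" "\<not> bip_cover E X' Y'"
    using bip_cover_number_le[of E] c(2) c'(2) e(2) f(2) by fastforce+
  then have a: "a \<notin> X" "a \<notin> X'"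
    using c(1) c'(1) by (auto simp: bip_cover_def)
  have b: "b' \<in> Y" "b \<in> Y'"
    using c(1) c'(1) a e(1) f(1) ne by (auto simp: bip_cover_def)
  have fins: "finite X" "finite Y" "finite X'" "finite Y'"
    using c(1) c'(1) by (auto simp: bip_cover_def)
  \<comment> \<open>The two deleted edges are covered by \<open>b\<close> and \<open>b'\<close>; any
    other edge is covered by both given covers.\<close>
  have "bip_cover E (X \<inter> X') (Y \<union> Y')"
    unfolding bip_cover_def
  proof (intro conjI ballI, goal_cases)
    case (3 g)
    then show ?case
      using b c(1) c'(1) by (cases "g = (a, b)"; cases "g = (a, b')") (auto simp: bip_cover_def)
  qed (use fins in auto)
  moreover have "bip_cover E (insert a (X \<union> X')) (Y \<inter> Y')"
    unfolding bip_cover_def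
  proof (intro conjI ballI, goal_cases)
    case (3 g)
    then show ?case
      using c(1) c'(1) by (cases "g = (a, b)"; cases "g = (a, b')") (auto simp: bip_cover_def)
  qed (use fins in auto)
  \<comment> \<open>By inclusion-exclusion the four sets have total size at most one more than
    \<open>X\<close>, \<open>Y\<close>, \<open>X'\<close>, \<open>Y'\<close> together, hence at most
    twice the optimum minus 1.\<close>
  ultimately have "2 * bip_cover_number E
      \<le> card (X \<inter> X') + card (Y \<union> Y') + (card (insert a (X \<union> X')) + card (Y \<inter> Y'))"
    using bip_cover_number_le by (metis add_mono mult_2)
  also have "card (insert a (X \<union> X')) \<le> Suc (card (X \<union> X'))"
    by (rule card_insert_le_m1) auto
  finally show False
    using card_Un_Int[OF fins(1,3)] card_Un_Int[OF fins(2,4)] c(2) c'(2) e(2) f(2) by linarith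
qed

text \<open>An edge whose deletion keeps the cover number is dropped by induction. If every edge is
  critical, no two share an end, so \<open>E\<close> itself is a matching.\<close>

theorem koenig:
  assumes "finite E"
  shows "\<exists>M\<subseteq>E. inj_on fst M \<and> inj_on snd M \<and> card M = bip_cover_number E"
  using assms
proof (induction "card E" arbitrary: E rule: less_induct)
  case less
  have mono: "bip_cover_number (E - {e}) \<le> bip_cover_number E" for e
    using bip_cover_number_attained[OF less.prems] bip_cover_number_le[of "E - {e}"]
    unfolding bip_cover_def by (metis DiffD1)
  show ?case
  proof (cases "\<exists>e\<in>E. bip_cover_number (E - {e}) = bip_cover_number E")
    case True
    then obtain e where e: "e \<in> E" "bip_cover_number (E - {e}) = bip_cover_number E"
      by blast
    from less.hyps[of "E - {e}"] e less.prems show ?thesis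
      by (metis Diff_subset card_Diff1_less finite_Diff subset_trans)
  next
    case False
    then have crit: "bip_cover_number (E - {e}) < bip_cover_number E" if "e \<in> E" for e
      using mono[of e] that by fastforce
    have fst: "inj_on fst E"
      using critical_edges_not_adjacent[OF less.prems] crit by (auto simp: inj_on_def)
    have snd: "inj_on snd E"
    proof (rule inj_onI, clarsimp)
      fix a a' b assume "(a, b) \<in> E" "(a', b) \<in> E"
      moreover have "prod.swap ` E - {(b, x)} = prod.swap ` (E - {(x, b)})" for x
        by force
      ultimately show "a = a'"
        using critical_edges_not_adjacent[of "prod.swap ` E" b a a'] crit less.prems
        by (simp add: bip_cover_number_swap)
    qed
    obtain X Y where XY: "bip_cover E X Y" "card X + card Y = bip_cover_number E"
      using bip_cover_number_attained[OF less.prems] by metis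
    \<comment> \<open>The left ends of all edges form a cover, so the matching \<open>E\<close> is
      large enough to contain one of the required size.\<close>
    have "bip_cover_number E \<le> card E"
      using bip_cover_number_le[of E "fst ` E" "{}"] card_image[OF fst] less.prems
      by (force simp: bip_cover_def)
    then obtain M where "M \<subseteq> E" "card M = bip_cover_number E"
      by (metis obtain_subset_with_card_n)
    then show ?thesis
      using fst snd inj_on_subset by metis
  qed
qed

section \<open>Packings and transversals\<close>

text \<open>\<open>vwalk_length\<close> is the list length minus 1, truncated at 0; as paths are
  nonempty, list lengths can be compared instead.\<close>

lemma geodesic_length_le:
  "\<lbrakk>geodesic G p; vpath q G; hd q = hd p; last q = last p\<rbrakk> \<Longrightarrow> length p \<le> length q"
proof -
  assume "geodesic G p" and q: "vpath q G" "hd q = hd p" "last q = last p"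
  then have "length p - 1 \<le> length q - 1" by (simp add: geodesic_def)
  moreover have "q \<noteq> []" using q(1) by (auto simp: vpath_def)
  ultimately show ?thesis by (cases q) auto
qed

section \<open>Reversal, maximality, and duality of packings and transversals\<close>

context pair_graph begin

lemma arc_sym: "(u, v) \<in> parcs G \<Longrightarrow> (v, u) \<in> parcs G"
  using pair_sym_arcs arcs_symmetric by blast

lemma vpath_rev: "vpath (rev p) G \<longleftrightarrow> vpath p G"
proof -
  have "vpath (rev p) G" if "vpath p G" for p
  proof -
    have "set (vwalk_arcs (rev p)) = (set (vwalk_arcs p))\<inverse>" for p :: "'a list"
    proof (induction p rule: vwalk_arcs.induct)
      case (3 x y xs)
      then show ?case
        using set_vwalk_arcs_snoc[of "rev xs @ [y]" x] by auto
    qed auto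
    with that show ?thesis
      by (auto simp: vpath_def vwalk_def intro: arc_sym)
  qed
  from this[of p] this[of "rev p"] show ?thesis by auto
qed

lemma geodesic_rev: "geodesic G (rev p) \<longleftrightarrow> geodesic G p"
proof -
  have "geodesic G (rev p)" if "geodesic G p" for p
    unfolding geodesic_def
  proof (intro conjI allI impI)
    from that have p: "vpath p G" "p \<noteq> []" by (auto simp: geodesic_def vpath_def)
    then show "vpath (rev p) G" by (simp add: vpath_rev)
    fix q assume q: "vpath q G \<and> hd q = hd (rev p) \<and> last q = last (rev p)"
    then have "q \<noteq> []" by (auto simp: vpath_def)
    then have "length p \<le> length (rev q)"
      using q p by (intro geodesic_length_le[OF that]) (auto simp: vpath_rev hd_rev last_rev)
    then show "vwalk_length (rev p) \<le> vwalk_length q" by simp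
  qed
  from this[of p] this[of "rev p"] show ?thesis by auto
qed

lemma maximal_geodesic_rev: "maximal_geodesic G (rev p) \<longleftrightarrow> maximal_geodesic G p"
proof -
  have "maximal_geodesic G (rev p)" if "maximal_geodesic G p" for p
    unfolding maximal_geodesic_def
  proof (intro conjI notI)
    show "geodesic G (rev p)"
      using that by (simp add: maximal_geodesic_def geodesic_rev)
    assume "\<exists>q. geodesic G q \<and> strict_sublist (rev p) q"
    then obtain q where "geodesic G q" "strict_sublist (rev p) q" by blast
    then have "geodesic G (rev q)" "strict_sublist p (rev q)"
      by (auto simp: geodesic_rev sublist_order.less_le sublist_rev_right)
    with that show False by (auto simp: maximal_geodesic_def)
  qed
  from this[of p] this[of "rev p"] show ?thesis by auto
qed

text \<open>A proper extension would attach a neighbor of one of the ends, but such a neighbor is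
  already on \<open>p\<close> and a path repeats no vertex.\<close>

lemma maximal_geodesicI:
  assumes p: "geodesic G p"
    and hd: "\<And>v. (v, hd p) \<in> parcs G \<Longrightarrow> v \<in> set p"
    and last: "\<And>v. (last p, v) \<in> parcs G \<Longrightarrow> v \<in> set p"
  shows "maximal_geodesic G p"
  unfolding maximal_geodesic_def
proof (intro conjI notI p)
  assume "\<exists>q. geodesic G q \<and> strict_sublist p q"
  then obtain us vs where q: "geodesic G (us @ p @ vs)" and ne: "us \<noteq> [] \<or> vs \<noteq> []"
    unfolding sublist_order.less_le sublist_def by force
  have "p \<noteq> []" using p by (auto simp: geodesic_def vpath_def)
  have d: "distinct (us @ p @ vs)" and A: "set (vwalk_arcs (us @ p @ vs)) \<subseteq> parcs G"
    using q by (auto simp: geodesic_def vpath_def vwalk_def)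
  have "us = []"
  proof (rule ccontr)
    assume "us \<noteq> []"
    then have "(last us, hd p) \<in> parcs G"
      using A \<open>p \<noteq> []\<close> by (simp add: vwalk_arcs_append)
    then show False using hd d last_in_set[OF \<open>us \<noteq> []\<close>] by auto
  qed
  moreover have "vs = []"
  proof (rule ccontr)
    assume "vs \<noteq> []"
    then have "(last p, hd vs) \<in> parcs G"
      using A \<open>p \<noteq> []\<close> \<open>us = []\<close> by (simp add: vwalk_arcs_append)
    then show False using last d hd_in_set[OF \<open>vs \<noteq> []\<close>] by auto
  qed
  ultimately show False using ne by simp
qed

text \<open>Weak duality: choosing a transversal vertex on each path is injective because the paths
  are disjoint.\<close>

lemma geodesic_packing_le_transversal:
  assumes P: "geodesic_packing G P" and S: "geodesic_transversal G S"
  shows "finite P \<and> card P \<le> card S"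
proof -
  define f where "f p = (SOME v. v \<in> set p \<inter> S)" for p
  have "finite S"
    using S pair_finite_verts by (metis finite_subset geodesic_transversal_def)
  have f: "f p \<in> set p \<inter> S" if "p \<in> P" for p
    unfolding f_def using that P S
    by (rule_tac someI_ex) (auto simp: geodesic_packing_def geodesic_transversal_def)
  have "inj_on f P"
  proof (rule inj_onI, rule ccontr)
    fix p q assume "p \<in> P" "q \<in> P" "f p = f q" "p \<noteq> q"
    then show False
      using f[of p] f[of q] P unfolding geodesic_packing_def by force
  qed
  moreover have "f ` P \<subseteq> S" using f by auto
  ultimately show ?thesis
    using \<open>finite S\<close> by (meson card_inj_on_le inj_on_finite)
qed

text \<open>Optimality certificate: by weak duality, a packing at least as large as a transversal
  makes both optimal. The size bounds also give the finiteness that \<open>Max\<close> and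
  \<open>Min\<close> require.\<close>

lemma gpack_eq_gtI:
  assumes P: "geodesic_packing G P" and S: "geodesic_transversal G S"
    and le: "card S \<le> card P"
  shows "gpack G = gt G"
proof -
  have eq: "card S = card P"
    using geodesic_packing_le_transversal[OF P S] le by simp
  have "gpack G = card P" unfolding gpack_def
  proof (rule Max_eqI)
    show "finite {card Q | Q. geodesic_packing G Q}"
      by (rule finite_subset[of _ "{..card S}"])
        (use geodesic_packing_le_transversal S in auto)
  qed (use P eq geodesic_packing_le_transversal[OF _ S] in auto)
  moreover have "gt G = card S" unfolding gt_def
  proof (rule Min_eqI)
    have "card T \<le> card (pverts G)" if "geodesic_transversal G T" for T
      using that pair_finite_verts by (metis card_mono geodesic_transversal_def)
    then show "finite {card T | T. geodesic_transversal G T}"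
      by (rule_tac finite_subset[of _ "{..card (pverts G)}"]) auto
    show "card S \<in> {card T | T. geodesic_transversal G T}"
      using S by blast
  qed (use eq geodesic_packing_le_transversal[OF P] in auto)
  ultimately show ?thesis using eq by simp
qed

end

section \<open>Silicate sheets\<close>

text \<open>Lists all candidates for a shorter path, so that geodesics with up to five vertices can
  be verified by cases.\<close>

lemma length_less_cases:
  "length q < 3 \<Longrightarrow> q = [] \<or> (\<exists>a. q = [a]) \<or> (\<exists>a b. q = [a, b])"
  "length q < 4 \<Longrightarrow> q = [] \<or> (\<exists>a. q = [a]) \<or> (\<exists>a b. q = [a, b]) \<or> (\<exists>a b c. q = [a, b, c])"
  "length q < 5 \<Longrightarrow> q = [] \<or> (\<exists>a. q = [a]) \<or> (\<exists>a b. q = [a, b]) \<or> (\<exists>a b c. q = [a, b, c])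
    \<or> (\<exists>a b c d. q = [a, b, c, d])"
  by (auto simp: numeral_eq_Suc less_Suc_eq length_Suc_conv)

locale silicate = pair_graph H for H :: "'a pair_pre_digraph" +
  fixes Si Ox :: "'a set"
  assumes verts_eq: "Si \<union> Ox = pverts H" and disjoint: "Si \<inter> Ox = {}"
    and bipartite: "parcs H \<subseteq> Si \<times> Ox \<union> Ox \<times> Si"
    and card_Si: "s \<in> Si \<Longrightarrow> card {x\<in>Ox. (s, x) \<in> parcs H} = 4"
    and card_Ox: "x \<in> Ox \<Longrightarrow> card {s\<in>Si. (x, s) \<in> parcs H} \<in> {1, 2}"
    and card_common: "\<lbrakk>s \<in> Si; t \<in> Si; s \<noteq> t\<rbrakk> \<Longrightarrow>
      card {x\<in>Ox. (s, x) \<in> parcs H \<and> (t, x) \<in> parcs H} \<le> 1"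
begin

text \<open>The pendant neighbors of \<open>s\<close>. Degree 1 is expressed by the uniqueness of
  the neighbor, the form in which maximality proofs use it.\<close>

definition pend :: "'a \<Rightarrow> 'a set" where
  "pend s = {x. (s, x) \<in> parcs H \<and> (\<forall>t. (t, x) \<in> parcs H \<longrightarrow> t = s)}"

lemma arcD: "(u, v) \<in> parcs H \<Longrightarrow> (u \<in> Si \<and> v \<in> Ox \<or> u \<in> Ox \<and> v \<in> Si)"
  using bipartite by auto

lemma arc_Si_iff: "(u, v) \<in> parcs H \<Longrightarrow> u \<in> Si \<longleftrightarrow> v \<notin> Si"
  using bipartite disjoint by auto

lemma arc_verts: "(u, v) \<in> parcs H \<Longrightarrow> u \<in> pverts H \<and> v \<in> pverts H"
  using arcD verts_eq by blast

lemma finite_Si: "finite Si" and finite_Ox: "finite Ox"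
  using verts_eq pair_finite_verts by (auto simp flip: verts_eq)

text \<open>In graph terms: \<open>H\<close> has no 4-cycle.\<close>

lemma common_unique:
  assumes "(s, x) \<in> parcs H" "(t, x) \<in> parcs H" "(s, y) \<in> parcs H" "(t, y) \<in> parcs H"
    and "s \<in> Si" "s \<noteq> t"
  shows "x = y"
proof -
  have Ox: "x \<in> Ox" "y \<in> Ox" using assms arcD disjoint by blast+
  have "t \<in> Si" using assms arc_Si_iff by blast
  then have "card {x\<in>Ox. (s, x) \<in> parcs H \<and> (t, x) \<in> parcs H} \<le> Suc 0"
    using card_common assms by simp
  then show ?thesis
    using assms Ox by (subst (asm) card_le_Suc0_iff_eq) (auto simp: finite_Ox)
qed

lemma Ox_neighbors:
  assumes "(s, x) \<in> parcs H" "(t, x) \<in> parcs H" "(u, x) \<in> parcs H" "x \<in> Ox" "s \<noteq> t"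
  shows "u = s \<or> u = t"
proof (rule ccontr)
  assume "\<not> ?thesis"
  then have "card {s, t, u} = 3" using assms(5) by auto
  moreover have "{s, t, u} \<subseteq> {s\<in>Si. (x, s) \<in> parcs H}"
    using assms arc_sym arcD disjoint by blast
  then have "card {s, t, u} \<le> card {s\<in>Si. (x, s) \<in> parcs H}"
    using finite_Si by (intro card_mono) auto
  ultimately show False using card_Ox[OF assms(4)] by auto
qed

lemma Ox_has_neighbor: "x \<in> Ox \<Longrightarrow> \<exists>s\<in>Si. (s, x) \<in> parcs H"
proof (rule ccontr)
  assume x: "x \<in> Ox" and "\<not> (\<exists>s\<in>Si. (s, x) \<in> parcs H)"
  then have "{s\<in>Si. (x, s) \<in> parcs H} = {}" using arc_sym by blast
  then show False using card_Ox[OF x] by (metis card.empty insertE singletonD zero_neq_numeral zero_neq_one)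
qed

lemma Si_other_neighbor: "s \<in> Si \<Longrightarrow> \<exists>y. (s, y) \<in> parcs H \<and> y \<noteq> x"
proof (rule ccontr)
  assume s: "s \<in> Si" and "\<not> (\<exists>y. (s, y) \<in> parcs H \<and> y \<noteq> x)"
  then have "{x\<in>Ox. (s, x) \<in> parcs H} \<subseteq> {x}" by auto
  then have "card {x\<in>Ox. (s, x) \<in> parcs H} \<le> 1"
    by (metis card_mono finite.emptyI finite_insert is_singletonI is_singleton_altdef)
  then show False using card_Si[OF s] by simp
qed

lemma not_pendE:
  assumes "(s, x) \<in> parcs H" "x \<notin> pend s"
  obtains t where "(t, x) \<in> parcs H" "t \<noteq> s"
  using assms by (auto simp: pend_def)

section \<open>Short geodesics in silicate sheets\<close>

lemma vpath_simps:
  "vpath [a] H \<longleftrightarrow> a \<in> pverts H"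
  "vpath (a # b # p) H \<longleftrightarrow> (a, b) \<in> parcs H \<and> a \<notin> set (b # p) \<and> vpath (b # p) H"
  using arc_verts by (auto simp: vpath_def vwalk_def)

lemma geodesicI:
  assumes "vpath p H" "\<And>q. \<lbrakk>vpath q H; hd q = hd p; last q = last p; length q < length p\<rbrakk> \<Longrightarrow> False"
  shows "geodesic H p"
  using assms by (fastforce simp: geodesic_def intro: diff_le_mono)

lemma vpath_not_Nil: "\<not> vpath [] H"
  by (simp add: vpath_def vwalk_def)

lemma geodesic_2:
  assumes "(u, v) \<in> parcs H"
  shows "geodesic H [u, v]"
proof (rule geodesicI)
  have ne: "u \<noteq> v" using assms arc_Si_iff by blast
  then show "vpath [u, v] H" using assms arc_verts by (simp add: vpath_simps)
  fix q assume "vpath q H" "hd q = hd [u, v]" "last q = last [u, v]" "length q < length [u, v]"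
  then show False using ne by (cases q) (auto simp: vpath_not_Nil)
qed

lemma geodesic_3:
  assumes "(u, v) \<in> parcs H" "(v, w) \<in> parcs H" "u \<noteq> w"
  shows "geodesic H [u, v, w]"
proof (rule geodesicI)
  have ne: "u \<noteq> v" "v \<noteq> w" using assms arc_Si_iff by blast+
  then show "vpath [u, v, w] H" using assms arc_verts by (simp add: vpath_simps)
  fix q assume "vpath q H" "hd q = hd [u, v, w]" "last q = last [u, v, w]" "length q < length [u, v, w]"
  moreover have "(u, w) \<notin> parcs H" using assms arc_Si_iff by blast
  ultimately show False using assms(3) length_less_cases(1)[of q]
    by (auto simp: vpath_not_Nil vpath_simps)
qed

text \<open>The ends lie in different classes, so a shorter path could only be the edge from
  \<open>x\<close> to \<open>t\<close>, which would close a 4-cycle with \<open>s\<close> and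
  \<open>y\<close>.\<close>

lemma geodesic_4:
  assumes "(x, s) \<in> parcs H" "(s, y) \<in> parcs H" "(y, t) \<in> parcs H" "x \<noteq> y" "s \<noteq> t" "s \<in> Si"
  shows "geodesic H [x, s, y, t]"
proof (rule geodesicI)
  have Si: "x \<notin> Si" "y \<notin> Si" "t \<in> Si" using assms arc_Si_iff by blast+
  then have ne: "x \<noteq> s" "y \<noteq> s" "x \<noteq> t" "y \<noteq> t" using assms by auto
  have no: "(x, t) \<notin> parcs H"
    using common_unique[of s x t y] assms arc_sym by blast
  show "vpath [x, s, y, t] H" using ne assms arc_verts by (auto simp add: vpath_simps)
  fix q assume "vpath q H" "hd q = hd [x, s, y, t]" "last q = last [x, s, y, t]"
    "length q < length [x, s, y, t]"
  then show False using Si no ne arc_Si_iff length_less_cases(2)[of q]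
    by (auto simp: vpath_not_Nil vpath_simps)
qed

section \<open>Maximal geodesics in silicate sheets\<close>

lemma maximal_geodesic_pend_pend:
  assumes "x \<in> pend s" "y \<in> pend s" "x \<noteq> y"
  shows "maximal_geodesic H [x, s, y]"
  using assms arc_sym by (intro maximal_geodesicI geodesic_3) (auto simp: pend_def)

text \<open>Every path from \<open>x\<close> to \<open>y\<close> starts with \<open>x\<close>,
  \<open>a\<close> and ends with \<open>b\<close>, \<open>y\<close>; the distinct silicon vertices
  \<open>a\<close> and \<open>b\<close> are not adjacent, so at least one more vertex lies between
  them.\<close>

lemma maximal_geodesic_pend_link_pend:
  assumes x: "x \<in> pend a" and y: "y \<in> pend b" and o: "(a, z) \<in> parcs H" "(b, z) \<in> parcs H"
    and ab: "a \<in> Si" "a \<noteq> b"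
  shows "maximal_geodesic H [x, a, z, b, y]"
proof (intro maximal_geodesicI geodesicI)
  have arcs: "(x, a) \<in> parcs H" "(a, z) \<in> parcs H" "(z, b) \<in> parcs H" "(b, y) \<in> parcs H"
    using assms arc_sym by (auto simp: pend_def)
  have Si: "x \<notin> Si" "z \<notin> Si" "b \<in> Si" "y \<notin> Si" using arcs ab arc_Si_iff by blast+
  have ne: "x \<noteq> z" "y \<noteq> z" "x \<noteq> y" using assms by (auto simp: pend_def)
  have u: "u = a" if "(x, u) \<in> parcs H" for u using that x arc_sym by (auto simp: pend_def)
  have w: "u = b" if "(u, y) \<in> parcs H" for u using that y by (auto simp: pend_def)
  show "vpath [x, a, z, b, y] H" using arcs Si ne ab arc_verts by (auto simp: vpath_simps)
  show "v \<in> set [x, a, z, b, y]" if "(v, hd [x, a, z, b, y]) \<in> parcs H" for v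
    using u that arc_sym by auto
  show "v \<in> set [x, a, z, b, y]" if "(last [x, a, z, b, y], v) \<in> parcs H" for v
    using w that arc_sym by auto
  fix q assume "vpath q H" "hd q = hd [x, a, z, b, y]" "last q = last [x, a, z, b, y]"
    "length q < length [x, a, z, b, y]"
  then show False using Si ne ab u w arc_Si_iff length_less_cases(3)[of q]
    by (auto simp: vpath_not_Nil vpath_simps)
qed

text \<open>A second silicon neighbor of \<open>y\<close> would extend the path, by
  \<open>geodesic_4\<close>.\<close>

lemma maximal_geodesic_last_pend:
  assumes max: "maximal_geodesic H [x, s, y]" and s: "s \<in> Si"
  shows "y \<in> pend s"
proof (rule ccontr)
  assume "y \<notin> pend s"
  moreover have p: "(x, s) \<in> parcs H" "(s, y) \<in> parcs H" "x \<noteq> y"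
    using max by (auto simp: maximal_geodesic_def geodesic_def vpath_simps)
  ultimately obtain t where t: "(t, y) \<in> parcs H" "t \<noteq> s" by (auto elim: not_pendE)
  have "geodesic H [x, s, y, t]"
    using p t s arc_sym by (intro geodesic_4) auto
  moreover have "sublist [x, s, y] ([x, s, y] @ [t])" by (rule sublist_append_rightI)
  ultimately show False
    using max by (auto simp: maximal_geodesic_def sublist_order.less_le)
qed

text \<open>Paths with at most two vertices can be extended. Three vertices centered at silicon have
  pendant ends; in all remaining cases two silicon vertices lie two steps apart on the path and
  share the oxygen between them.\<close>

lemma maximal_geodesic_cases:
  assumes max: "maximal_geodesic H p"
  shows "(\<exists>s\<in>Si. \<exists>x\<in>pend s. \<exists>y\<in>pend s. s \<in> set p \<and> x \<noteq> y) \<or>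
    (\<exists>s\<in>Si. \<exists>t\<in>Si. \<exists>x. s \<in> set p \<and> t \<in> set p \<and> s \<noteq> t \<and> (s, x) \<in> parcs H \<and> (t, x) \<in> parcs H)"
proof -
  have path: "vpath p H" using max by (simp add: maximal_geodesic_def geodesic_def)
  have ext: False if "geodesic H q" "q = us @ p @ vs" "us @ vs \<noteq> []" for q us vs
  proof -
    have "length q \<noteq> length p" using that(2,3) by auto
    then have "p \<noteq> q" by auto
    moreover have "sublist p q" using that(2) by (auto simp: sublist_def)
    ultimately show False
      using max that(1) by (auto simp: maximal_geodesic_def sublist_order.less_le)
  qed
  have link: ?thesis
    if "s \<in> Si" "t \<in> Si" "s \<in> set p" "t \<in> set p" "s \<noteq> t" "(s, x) \<in> parcs H" "(x, t) \<in> parcs H" for s t x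
    using that arc_sym by blast
  consider "p = []" | a where "p = [a]" | a b where "p = [a, b]" | a b c where "p = [a, b, c]"
    | a b c d p' where "p = a # b # c # d # p'"
    \<comment> \<open>This rule serves only as a case split of lists into empty, singleton, and at
      least two elements.\<close>
    by (metis remdups_adj.cases)
  then show ?thesis
  proof cases
    case 1
    then show ?thesis using path by (simp add: vpath_not_Nil)
  next
    case 2
    then have "a \<in> Si \<or> a \<in> Ox" using path verts_eq by (auto simp: vpath_simps)
    then obtain b where "(a, b) \<in> parcs H"
      using Si_other_neighbor Ox_has_neighbor arc_sym by metis
    from ext[OF geodesic_2[OF this], of "[]" "[b]"] 2 show ?thesis by simp
  next
    case 3
    then have ab: "(a, b) \<in> parcs H" using path by (simp add: vpath_simps)
    show ?thesis
    proof (cases "a \<in> Si")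
      case True
      then obtain c where c: "(a, c) \<in> parcs H" "c \<noteq> b" using Si_other_neighbor by blast
      have "geodesic H [c, a, b]" using c ab arc_sym by (intro geodesic_3) auto
      from ext[OF this, of "[c]" "[]"] 3 show ?thesis by simp
    next
      case False
      then have "b \<in> Si" using ab arc_Si_iff by blast
      then obtain c where c: "(b, c) \<in> parcs H" "c \<noteq> a" using Si_other_neighbor by blast
      have "geodesic H [a, b, c]" using c ab by (intro geodesic_3) auto
      from ext[OF this, of "[]" "[c]"] 3 show ?thesis by simp
    qed
  next
    case 4
    then have abc: "(a, b) \<in> parcs H" "(b, c) \<in> parcs H" "a \<noteq> c"
      using path by (auto simp: vpath_simps)
    show ?thesis
    proof (cases "b \<in> Si")
      case True
      have "maximal_geodesic H [c, b, a]"
        using max 4 maximal_geodesic_rev[of "[a, b, c]"] by simp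
      then have "a \<in> pend b" "c \<in> pend b"
        using maximal_geodesic_last_pend True max 4 by blast+
      then show ?thesis using True abc 4 by auto
    next
      case False
      then have "a \<in> Si" "c \<in> Si" using abc arc_Si_iff by blast+
      then show ?thesis using abc 4 by (intro link[of a c b]) auto
    qed
  next
    case 5
    then have *: "(a, b) \<in> parcs H" "(b, c) \<in> parcs H" "(c, d) \<in> parcs H" "a \<noteq> c" "b \<noteq> d"
      using path by (auto simp: vpath_simps)
    show ?thesis
    proof (cases "a \<in> Si")
      case True
      then have "c \<in> Si" using * arc_Si_iff by blast
      then show ?thesis using True * 5 by (intro link[of a c b]) auto
    next
      case False
      then have "b \<in> Si" "d \<in> Si" using * arc_Si_iff by blast+
      then show ?thesis using * 5 by (intro link[of b d c]) auto
    qed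
  qed
qed

text \<open>The hexagonal structure enters only through the two hypotheses; \<open>col\<close> is a
  proper 2-coloring of the link graph.\<close>

theorem gpack_eq_gt:
  assumes pend: "\<And>s. s \<in> Si \<Longrightarrow> pend s \<noteq> {}"
    and col: "\<And>s t x. \<lbrakk>s \<in> Si; t \<in> Si; s \<noteq> t; (s, x) \<in> parcs H; (t, x) \<in> parcs H\<rbrakk> \<Longrightarrow>
      col s \<longleftrightarrow> \<not> col t"
  shows "gpack H = gt H"
proof -
  define D where "D = {s\<in>Si. \<exists>x\<in>pend s. \<exists>y\<in>pend s. x \<noteq> y}"
  \<comment> \<open>The links outside \<open>D\<close>, each oriented by color, so that the color
    classes are the two sides for Koenig's theorem.\<close>
  define E where "E = {(a, b). a \<in> Si - D \<and> b \<in> Si - D \<and> col a \<and> \<not> col b \<and>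
    (\<exists>x. (a, x) \<in> parcs H \<and> (b, x) \<in> parcs H)}"
  have "E \<subseteq> Si \<times> Si" by (auto simp: E_def)
  then have finE: "finite E" using finite_Si finite_subset by blast
  have finD: "finite D" using finite_Si by (simp add: D_def)
  obtain M where M: "M \<subseteq> E" "inj_on fst M" "inj_on snd M" "card M = bip_cover_number E"
    using koenig[OF finE] by metis
  obtain X Y where XY: "bip_cover E X Y" "card X + card Y = bip_cover_number E"
    using bip_cover_number_attained[OF finE] by metis
  \<comment> \<open>A cover may contain arbitrary elements; intersecting with \<open>Si\<close>
    keeps \<open>T\<close> inside the graph.\<close>
  define T where "T = D \<union> (X \<union> Y) \<inter> Si"

  have "\<forall>s. \<exists>x y. s \<in> D \<longrightarrow> x \<in> pend s \<and> y \<in> pend s \<and> x \<noteq> y"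
    by (auto simp: D_def)
  then obtain p p' where p: "\<And>s. s \<in> D \<Longrightarrow> p s \<in> pend s \<and> p' s \<in> pend s \<and> p s \<noteq> p' s"
    by metis
  have "\<forall>s. \<exists>x. s \<in> Si \<longrightarrow> x \<in> pend s"
    using pend by blast
  then obtain l where l: "\<And>s. s \<in> Si \<Longrightarrow> l s \<in> pend s" by metis
  have "\<forall>a b. \<exists>x. (a, b) \<in> E \<longrightarrow> (a, x) \<in> parcs H \<and> (b, x) \<in> parcs H"
    by (auto simp: E_def)
  then obtain m where m: "\<And>a b. (a, b) \<in> E \<Longrightarrow> (a, m a b) \<in> parcs H \<and> (b, m a b) \<in> parcs H"
    by metis
  define star where "star s = [p s, s, p' s]" for s
  define link where "link = (\<lambda>(a, b). [l a, a, m a b, b, l b])"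
  define P where "P = star ` D \<union> link ` M"

  \<comment> \<open>The silicon entries of a list determine its index, and the lengths 3 and 5
    separate the two families.\<close>
  have "inj_on star D" by (auto simp: star_def inj_on_def)
  moreover have "inj_on link M" by (auto simp: link_def inj_on_def)
  moreover have "star ` D \<inter> link ` M = {}" by (auto simp: star_def link_def)
  moreover have "finite M" using M(1) finE by (rule finite_subset)
  ultimately have cardP: "card P = card D + card M"
    unfolding P_def using finD by (subst card_Un_disjoint) (auto simp: card_image)

  have "card T \<le> card D + card ((X \<union> Y) \<inter> Si)" unfolding T_def by (rule card_Un_le)
  also have "card ((X \<union> Y) \<inter> Si) \<le> card (X \<union> Y)"
    using XY(1) by (intro card_mono) (auto simp: bip_cover_def)
  also have "card (X \<union> Y) \<le> card X + card Y" by (rule card_Un_le)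
  finally have le: "card T \<le> card P" using cardP XY(2) M(4) by simp

  have "geodesic_transversal H T"
    unfolding geodesic_transversal_def
  proof (intro conjI allI impI)
    show "T \<subseteq> pverts H" using verts_eq by (auto simp: T_def D_def)
    fix q assume "maximal_geodesic H q"
    then consider s where "s \<in> D" "s \<in> set q"
      | s t x where "s \<in> Si" "t \<in> Si" "s \<in> set q" "t \<in> set q" "s \<noteq> t" "(s, x) \<in> parcs H" "(t, x) \<in> parcs H"
      unfolding D_def by (drule_tac maximal_geodesic_cases) blast
    then show "set q \<inter> T \<noteq> {}"
    proof cases
      case 2
      \<comment> \<open>Linked vertices have different colors, so outside \<open>D\<close> one of
        the two orientations lies in \<open>E\<close>.\<close>
      then have "s \<in> D \<or> t \<in> D \<or> (s, t) \<in> E \<or> (t, s) \<in> E"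
        using col[of s t x] by (auto simp: E_def)
      then show ?thesis using 2 XY(1) by (auto simp: T_def bip_cover_def)
    qed (auto simp: T_def)
  qed
  moreover have "geodesic_packing H P"
    unfolding geodesic_packing_def
  proof (intro conjI ballI impI)
    have maxi: "maximal_geodesic H (link e)" if "e \<in> E" for e
      using that l m by (auto simp: link_def E_def intro!: maximal_geodesic_pend_link_pend)
    then show "maximal_geodesic H q" if "q \<in> P" for q
      using that p M(1) by (auto simp: P_def star_def intro: maximal_geodesic_pend_pend)
    have star_Si: "set (star s) \<inter> Si = {s}" if "s \<in> D" for s
      using that p[OF that] arc_Si_iff by (auto simp: star_def pend_def D_def)
    have link_Si: "set (link (a, b)) \<inter> Si = {a, b}" if "(a, b) \<in> E" for a b
      using that l[of a] l[of b] m[OF that] arc_Si_iff by (auto simp: link_def pend_def E_def)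
    \<comment> \<open>Each path of \<open>P\<close> contains, with an oxygen vertex, all its silicon
      neighbors. Hence two paths sharing any vertex share a silicon vertex, and only those need
      comparison.\<close>
    have closed: "s \<in> set q" if "q \<in> P" "x \<in> set q" "x \<in> Ox" "(s, x) \<in> parcs H" for q x s
    proof -
      consider t where "t \<in> D" "q = star t" | a b where "(a, b) \<in> E" "q = link (a, b)"
        using \<open>q \<in> P\<close> M(1) by (auto simp: P_def)
      then show ?thesis
      proof cases
        case 1
        then show ?thesis
          using that p[of t] disjoint by (auto simp: star_def pend_def D_def)
      next
        case 2
        then have "a \<in> Si" "b \<in> Si" "a \<noteq> b" by (auto simp: E_def)
        then show ?thesis
          using that 2 l[of a] l[of b] m[of a b] disjoint Ox_neighbors[of a "m a b" b s]
          by (auto simp: link_def pend_def)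
      qed
    qed
    fix q q' assume q: "q \<in> P" "q' \<in> P" "q \<noteq> q'"
    have DE: "a \<notin> D" "b \<notin> D" "col a" "\<not> col b" if "(a, b) \<in> E" for a b
      using that by (auto simp: E_def)
    have MM: "a \<noteq> c \<and> b \<noteq> d" if "(a, b) \<in> M" "(c, d) \<in> M" "(a, b) \<noteq> (c, d)" for a b c d
      using that M(2,3) by (force simp: inj_on_def)
    have "set q \<inter> set q' \<inter> Si = (set q \<inter> Si) \<inter> (set q' \<inter> Si)" by blast
    also have "\<dots> = {}"
    proof -
      consider s t where "s \<in> D" "t \<in> D" "q = star s" "q' = star t"
        | s c d where "s \<in> D" "(c, d) \<in> M" "q = star s" "q' = link (c, d)"
        | a b t where "(a, b) \<in> M" "t \<in> D" "q = link (a, b)" "q' = star t"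
        | a b c d where "(a, b) \<in> M" "(c, d) \<in> M" "q = link (a, b)" "q' = link (c, d)"
        using q(1,2) unfolding P_def by force
      then show ?thesis
      proof cases
        case 1
        then show ?thesis using q(3) star_Si by auto
      next
        case 2
        then have "(c, d) \<in> E" using M(1) by blast
        then show ?thesis using 2 star_Si[of s] link_Si[of c d] DE by auto
      next
        case 3
        then have "(a, b) \<in> E" using M(1) by blast
        then show ?thesis using 3 star_Si[of t] link_Si[of a b] DE by auto
      next
        case 4
        \<comment> \<open>The matching separates ends on the same side; the colors separate ends on
          opposite sides.\<close>
        then have "(a, b) \<in> E" "(c, d) \<in> E" using M(1) by blast+
        moreover have "a \<noteq> c \<and> b \<noteq> d" using MM 4 q(3) by blast
        ultimately show ?thesis using 4 link_Si DE(3,4)[of a b] DE(3,4)[of c d] by auto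
      qed
    qed
    finally have none: "set q \<inter> set q' \<inter> Si = {}" .
    show "set q \<inter> set q' = {}"
    proof (rule ccontr)
      assume "set q \<inter> set q' \<noteq> {}"
      then obtain x where x: "x \<in> set q" "x \<in> set q'" by blast
      moreover have "set q \<subseteq> pverts H"
        using q(1) maxi p M(1) maximal_geodesic_pend_pend
        by (fastforce simp: P_def star_def maximal_geodesic_def geodesic_def vpath_def vwalk_def)
      ultimately have "x \<in> Ox" using none verts_eq by blast
      then obtain s where "s \<in> Si" "(s, x) \<in> parcs H" using Ox_has_neighbor by blast
      then show False using closed q x \<open>x \<in> Ox\<close> none by blast
    qed
  qed
  ultimately show ?thesis using le gpack_eq_gtI by blast
qed

end

section \<open>Smoothing and the hexagonal lattice\<close>

lemma out_degree_with_proj: "out_degree (with_proj G) v = card {w. (v, w) \<in> parcs G}"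
proof -
  have "out_arcs (with_proj G) v = Pair v ` {w. (v, w) \<in> parcs G}"
    by (auto simp: out_arcs_def)
  then show ?thesis by (simp add: out_degree_def card_image inj_on_def)
qed

section \<open>Coloring and degrees of the hexagonal lattice\<close>

lemma hex_lattice_color: "((a, b, c), (a', b', c')) \<in> hex_lattice_arcs \<Longrightarrow> c \<longleftrightarrow> \<not> c'"
  by (auto simp: hex_lattice_arcs_def symcl_def)

lemma hex_lattice_degree:
  "finite {h. (g, h) \<in> hex_lattice_arcs} \<and> card {h. (g, h) \<in> hex_lattice_arcs} \<le> 3"
proof -
  obtain a b c where g: "g = (a, b, c)" by (metis prod_cases3)
  define N where "N = (if c then {(a, b, False), (a + 1, b, False), (a, b + 1, False)}
    else {(a, b, True), (a - 1, b, True), (a, b - 1, True)})"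
  have "finite N" by (simp add: N_def)
  have "{h. (g, h) \<in> hex_lattice_arcs} \<subseteq> N"
    by (auto simp: N_def g hex_lattice_arcs_def symcl_def)
  moreover have "card N \<le> 3" by (simp add: N_def card_insert_if)
  ultimately show ?thesis
    using \<open>finite N\<close> by (meson card_mono finite_subset le_trans)
qed

lemma carbon_nanosheet_arcs: "parcs (carbon_nanosheet r) \<subseteq> hex_lattice_arcs"
  by (auto simp: carbon_nanosheet_def hexagon_arcs_def)

text \<open>Keeps only an injective vertex map that preserves arcs: the degree bound and the
  coloring need just an embedding.\<close>

lemma digraph_iso_with_projE:
  assumes "digraph_iso G (with_proj K)"
  obtains f where "inj_on f (verts G)"
    "\<And>e. e \<in> arcs G \<Longrightarrow> (f (tail G e), f (head G e)) \<in> parcs K"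
proof -
  obtain h where h: "pre_digraph.digraph_isomorphism G h" and K: "with_proj K = app_iso h G"
    using assms by (auto simp: digraph_iso_def)
  have "iso_tail h = fst" "iso_head h = snd" "parcs K = iso_arcs h ` arcs G"
    using arg_cong[OF K, of tail] arg_cong[OF K, of head] arg_cong[OF K, of arcs] by auto
  then have "(iso_verts h (tail G e), iso_verts h (head G e)) \<in> parcs K" if "e \<in> arcs G" for e
    using h that by (simp add: pre_digraph.digraph_isomorphism_def)
  then show ?thesis
    using that h by (auto simp: pre_digraph.digraph_isomorphism_def)
qed

context silicate begin

text \<open>Closed form for smoothing all of \<open>W\<close> at once, intended for sets of oxygen
  vertices. These are pairwise non-adjacent, so the single steps do not interfere.\<close>

definition smoothed :: "'a set \<Rightarrow> 'a pair_pre_digraph" where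
  "smoothed W = \<lparr>pverts = pverts H - W,
     parcs = {(u, v) \<in> parcs H. u \<notin> W \<and> v \<notin> W} \<union>
       {(s, t). s \<noteq> t \<and> (\<exists>x\<in>W. (s, x) \<in> parcs H \<and> (x, t) \<in> parcs H)}\<rparr>"

lemma smooth_smoothed:
  assumes "v \<in> Ox" "W \<subseteq> Ox" "v \<notin> W"
  shows "smooth v (smoothed W) = smoothed (insert v W)"
proof -
  have Si: "s \<in> Si \<and> s \<notin> W \<and> s \<noteq> v" if "(s, x) \<in> parcs H \<or> (x, s) \<in> parcs H" "x = v \<or> x \<in> W" for s x
    using that assms arcD disjoint by blast
  have 1: "(x, v) \<in> parcs (smoothed W) \<longleftrightarrow> (x, v) \<in> parcs H" for x
    using Si assms(3) unfolding smoothed_def by auto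
  have 2: "(v, x) \<in> parcs (smoothed W) \<longleftrightarrow> (v, x) \<in> parcs H" for x
    using Si assms(3) unfolding smoothed_def by auto
  have "parcs (smooth v (smoothed W)) = parcs (smoothed (insert v W))"
    unfolding smooth_def pair_pre_digraph.select_convs 1 2
    unfolding smoothed_def pair_pre_digraph.select_convs using Si by blast
  then show ?thesis by (auto simp: smooth_def smoothed_def)
qed

lemma fold_smooth:
  "\<lbrakk>distinct vs; set vs \<subseteq> Ox; W \<subseteq> Ox; set vs \<inter> W = {}\<rbrakk> \<Longrightarrow>
    fold smooth vs (smoothed W) = smoothed (W \<union> set vs)"
  by (induction vs arbitrary: W) (auto simp: smooth_smoothed)

lemma is_SM_eq_smoothed:
  assumes "is_SM H K"
  shows "K = smoothed {x\<in>Ox. out_degree H x = 2}"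
proof -
  obtain vs where vs: "distinct vs" "set vs = {v \<in> pverts H. out_degree H v = 2}"
    and K: "K = fold smooth vs H"
    using assms by (auto simp: is_SM_def)
  \<comment> \<open>This excludes silicon from the vertices of degree 2, so only oxygen gets
    smoothed.\<close>
  have "out_degree H s = 4" if "s \<in> Si" for s
  proof -
    have "{w. (s, w) \<in> parcs H} = {x\<in>Ox. (s, x) \<in> parcs H}"
      using that arcD disjoint by blast
    then show ?thesis using card_Si[OF that] by (simp add: out_degree_with_proj)
  qed
  then have "set vs = {x\<in>Ox. out_degree H x = 2}"
    using vs(2) by (auto simp flip: verts_eq)
  moreover have "H = smoothed {}" by (simp add: smoothed_def)
  ultimately show ?thesis
    using fold_smooth[of vs "{}"] vs(1) K by simp
qed

text \<open>Shared oxygen vertices are thus among the smoothed ones, which turns links into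
  arcs.\<close>

lemma shared_degree_2:
  assumes "s \<in> Si" "s \<noteq> t" "(s, x) \<in> parcs H" "(t, x) \<in> parcs H"
  shows "x \<in> Ox" "t \<in> Si" "out_degree H x = 2"
proof -
  show x: "x \<in> Ox" using assms arcD disjoint by blast
  then show "t \<in> Si" using assms arcD disjoint by blast
  have "{w. (x, w) \<in> parcs H} = {s, t}"
    using assms x Ox_neighbors arc_sym by blast
  then show "out_degree H x = 2"
    using assms(2) by (simp add: out_degree_with_proj)
qed

text \<open>Ensures that no silicon vertex is deleted as pendant. Each oxygen neighbor yields its
  own neighbor after smoothing: itself if pendant, otherwise the silicon vertex behind it;
  \<open>R\<close> records this, and \<open>common_unique\<close> makes it injective.\<close>

lemma smoothed_Si_degree:
  assumes "s \<in> Si"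
  shows "4 \<le> out_degree (smoothed {x\<in>Ox. out_degree H x = 2}) s"
proof -
  define K where "K = smoothed {x\<in>Ox. out_degree H x = 2}"
  have s: "s \<notin> Ox" using assms disjoint by blast
  define R where "R x w \<longleftrightarrow> w = x \<or> w \<in> Si \<and> w \<noteq> s \<and> (w, x) \<in> parcs H" for x w
  have sub: "parcs K \<subseteq> pverts H \<times> pverts H"
    using arc_verts unfolding K_def smoothed_def by auto
  have "card {x\<in>Ox. (s, x) \<in> parcs H} \<le> card {w. (s, w) \<in> parcs K}"
  proof (rule card_le_if_inj_on_rel[where r = R])
    have "{w. (s, w) \<in> parcs K} \<subseteq> pverts H" using sub by blast
    then show "finite {w. (s, w) \<in> parcs K}" by (rule finite_subset[OF _ pair_finite_verts])
  next
    fix x assume x: "x \<in> {x\<in>Ox. (s, x) \<in> parcs H}"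
    show "\<exists>w. w \<in> {w. (s, w) \<in> parcs K} \<and> R x w"
    proof (cases "x \<in> pend s")
      case True
      then have "{w. (x, w) \<in> parcs H} \<subseteq> {s}" using arc_sym by (auto simp: pend_def)
      then have "card {w. (x, w) \<in> parcs H} \<le> 1"
        by (metis card_mono finite.emptyI finite_insert is_singletonI is_singleton_altdef)
      then have "(s, x) \<in> parcs K"
        using x s by (simp add: K_def smoothed_def out_degree_with_proj)
      then show ?thesis by (auto simp: R_def)
    next
      case False
      then obtain t where t: "(t, x) \<in> parcs H" "t \<noteq> s" using x by (auto elim: not_pendE)
      then have "t \<in> Si" "out_degree H x = 2" using shared_degree_2[of s t x] assms x by auto
      then show ?thesis
        using t x arc_sym by (intro exI[of _ t]) (auto simp: R_def K_def smoothed_def)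
    qed
  next
    fix x y w assume "x \<in> {x\<in>Ox. (s, x) \<in> parcs H}" "y \<in> {x\<in>Ox. (s, x) \<in> parcs H}" "R x w" "R y w"
    then show "x = y"
      using disjoint common_unique[of s x w y] assms by (auto simp: R_def)
  qed
  then show ?thesis using card_Si[OF assms] by (simp add: out_degree_with_proj K_def)
qed

text \<open>The isomorphism embeds the link graph into the hexagonal lattice, whose degree bound and
  Boolean coordinate supply the hypotheses of \<open>gpack_eq_gt\<close>.\<close>

theorem hexagonal_gpack_eq_gt:
  assumes K: "is_SM H K" and iso: "digraph_iso (delete_pendants K) (with_proj (carbon_nanosheet r))"
  shows "gpack H = gt H"
proof -
  have K_eq: "K = smoothed {x\<in>Ox. out_degree H x = 2}"
    using K by (rule is_SM_eq_smoothed)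
  obtain f where inj: "inj_on f (verts (delete_pendants K))"
    and f: "\<And>e. e \<in> arcs (delete_pendants K) \<Longrightarrow>
      (f (fst e), f (snd e)) \<in> parcs (carbon_nanosheet r)"
    using digraph_iso_with_projE[OF iso] by (auto simp: delete_pendants_def)
  have Si: "Si \<subseteq> {v \<in> pverts K. out_degree K v \<noteq> 1}"
    using smoothed_Si_degree disjoint verts_eq by (fastforce simp: K_eq smoothed_def)
  then have inj_Si: "inj_on f Si"
    using inj by (auto simp: delete_pendants_def intro: inj_on_subset)
  have adj: "(f s, f t) \<in> hex_lattice_arcs"
    if "s \<in> Si" "s \<noteq> t" "(s, x) \<in> parcs H" "(t, x) \<in> parcs H" for s t x
  proof -
    note shared_degree_2[OF that]
    then have "(s, t) \<in> parcs K" "t \<in> Si"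
      using that arc_sym by (auto simp: K_eq smoothed_def)
    then have "(s, t) \<in> arcs (delete_pendants K)"
      using Si that(1) by (auto simp: delete_pendants_def)
    then show ?thesis using f carbon_nanosheet_arcs by fastforce
  qed
  show ?thesis
  proof (rule gpack_eq_gt)
    fix s assume s: "s \<in> Si"
    show "pend s \<noteq> {}"
    proof
      assume none: "pend s = {}"
      \<comment> \<open>Without pendant neighbors, the four oxygen vertices at \<open>s\<close>
        would lead to four distinct lattice neighbors of \<open>f s\<close>, which has at most
        three.\<close>
      have "card {x\<in>Ox. (s, x) \<in> parcs H} \<le> card {h. (f s, h) \<in> hex_lattice_arcs}"
      proof (rule card_le_if_inj_on_rel[where
            r = "\<lambda>x h. \<exists>t\<in>Si. t \<noteq> s \<and> (t, x) \<in> parcs H \<and> h = f t"])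
        show "finite {h. (f s, h) \<in> hex_lattice_arcs}" using hex_lattice_degree by blast
      next
        fix x assume x: "x \<in> {x\<in>Ox. (s, x) \<in> parcs H}"
        then obtain t where t: "(t, x) \<in> parcs H" "t \<noteq> s" using none by (auto elim: not_pendE)
        then show "\<exists>h. h \<in> {h. (f s, h) \<in> hex_lattice_arcs} \<and>
            (\<exists>t\<in>Si. t \<noteq> s \<and> (t, x) \<in> parcs H \<and> h = f t)"
          using adj[of s t x] s x shared_degree_2(2)[of s t x] by blast
      next
        fix x y h assume "x \<in> {x\<in>Ox. (s, x) \<in> parcs H}" "y \<in> {x\<in>Ox. (s, x) \<in> parcs H}"
          "\<exists>t\<in>Si. t \<noteq> s \<and> (t, x) \<in> parcs H \<and> h = f t"
          "\<exists>t\<in>Si. t \<noteq> s \<and> (t, y) \<in> parcs H \<and> h = f t"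
        then show "x = y"
          using inj_Si s common_unique[of s x _ y] by (auto dest: inj_onD)
      qed
      then show False using card_Si[OF s] hex_lattice_degree[of "f s"] by linarith
    qed
  next
    fix s t x
    assume "s \<in> Si" "t \<in> Si" "s \<noteq> t" "(s, x) \<in> parcs H" "(t, x) \<in> parcs H"
    then have "(f s, f t) \<in> hex_lattice_arcs" using adj by blast
    then show "snd (snd (f s)) \<longleftrightarrow> \<not> snd (snd (f t))"
      using hex_lattice_color by (metis prod.collapse)
  qed
qed

end

theorem theorem5p2:
  fixes H :: "'a pair_pre_digraph" and r :: nat
  assumes "r \<ge> 1"
    and "hexagonal_silicate_sheet r H"
  shows "gpack H = gt H"
proof -
  obtain K where H: "silicate_sheet H" and K: "is_SM H K"
    "digraph_iso (delete_pendants K) (with_proj (carbon_nanosheet r))"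
    using assms(2) by (auto simp: hexagonal_silicate_sheet_def)
  have "\<exists>Si Ox. silicate_axioms H Si Ox"
    using H unfolding silicate_sheet_def silicate_axioms_def by (elim conjE ex_forward) simp
  then obtain Si Ox where "silicate H Si Ox"
    using H by (auto simp: silicate_sheet_def silicate_def)
  then interpret silicate H Si Ox .
  show ?thesis using K by (rule hexagonal_gpack_eq_gt)
qed

end
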